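(* For any finite, simple, connected, undirected graphs $G$ and $H$, $$\gamma(G\,\square\, H)\geq \frac{\pi(G)}{2\pi(G)-1}\,\gamma(G)\,\gamma(H).$$
   Context: All graphs are finite, simple, connected and undirected (with nonempty vertex set). For a graph $G$ and $v\in V(G)$, $N[v]$ denotes the closed neighborhood of $v$ (that is, $v$ together with all its neighbors), and $N[S]=\bigcup_{v\in S}N[v]$ for $S\subseteq V(G)$. A set $S\subseteq V(G)$ dominates $G$ if $N[S]=V(G)$. The domination number $\gamma(G)$ is the minimum cardinality of a set that dominates $G$; a dominating set of cardinality $\gamma(G)$ is called a $\gamma$-set of $G$. The Cartesian product $G\,\square\,H$ is the graph with vertex set $V(G)\times V(H)$ in which $(u_1,v_1)$ and $(u_2,v_2)$ are adjacent if and only if either $v_1=v_2$ and $u_1u_2\in E(G)$, or $u_1=u_2$ and $v_1v_2\in E(H)$. For a $\gamma$-set $D$ of $G$, the allegiance of $D$ with respect to $G$ is $a_G(D)=\max_{v\in V(G)}|D\cap N[v]|$. The power of $G$ is $\pi(G)=\min_D a_G(D)$, where the minimum is taken over all $\gamma$-sets $D$ of $G$. *)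

theory Defs
  imports Complex_Main "Graph_Theory.Digraph_Component"
begin

text \<open>
  Finite simple undirected graphs are rendered by \<^locale>\<open>pair_graph\<close>: an undirected edge
  \<open>uv\<close> is represented by the two arcs \<open>(u, v)\<close> and \<open>(v, u)\<close>. The null graph is excluded by
  \<^const>\<open>Digraph_Component.connected\<close>, which requires a nonempty vertex set.
\<close>

definition closed_nbhd :: "'a pair_pre_digraph \<Rightarrow> 'a \<Rightarrow> 'a set" where
  "closed_nbhd G v = insert v {w. (v, w) \<in> parcs G}"

definition closed_nbhd_set :: "'a pair_pre_digraph \<Rightarrow> 'a set \<Rightarrow> 'a set" where
  "closed_nbhd_set G S = (\<Union>v\<in>S. closed_nbhd G v)"

definition dominating_set :: "'a pair_pre_digraph \<Rightarrow> 'a set \<Rightarrow> bool" where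
  "dominating_set G S \<longleftrightarrow> S \<subseteq> pverts G \<and> closed_nbhd_set G S = pverts G"

definition domination_number :: "'a pair_pre_digraph \<Rightarrow> nat" where
  "domination_number G = Min (card ` {S. dominating_set G S})"

definition gamma_set :: "'a pair_pre_digraph \<Rightarrow> 'a set \<Rightarrow> bool" where
  "gamma_set G D \<longleftrightarrow> dominating_set G D \<and> card D = domination_number G"

definition allegiance :: "'a pair_pre_digraph \<Rightarrow> 'a set \<Rightarrow> nat" where
  "allegiance G D = Max ((\<lambda>v. card (D \<inter> closed_nbhd G v)) ` pverts G)"

definition graph_power :: "'a pair_pre_digraph \<Rightarrow> nat" where
  "graph_power G = Min (allegiance G ` {D. gamma_set G D})"

definition cartesian_product ::
    "'a pair_pre_digraph \<Rightarrow> 'b pair_pre_digraph \<Rightarrow> ('a \<times> 'b) pair_pre_digraph"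
    (infixl \<open>\<box>\<close> 70) where
  "G \<box> H = \<lparr> pverts = pverts G \<times> pverts H,
     parcs = {((u1, v1), (u2, v2)) | u1 v1 u2 v2.
       v1 = v2 \<and> v1 \<in> pverts H \<and> (u1, u2) \<in> parcs G \<or>
       u1 = u2 \<and> u1 \<in> pverts G \<and> (v1, v2) \<in> parcs H} \<rparr>"

text \<open>
  The minima and maxima above are taken over finite nonempty sets whenever the graph is a
  nonempty \<^locale>\<open>pair_graph\<close>, so they are attained; and the product is again such a graph.
\<close>

context pair_graph
begin

lemma finite_dominating_sets: "finite {S. dominating_set G S}"
  by (rule finite_subset[of _ "Pow (pverts G)"])
    (auto simp: dominating_set_def pair_finite_verts)

lemma dominating_set_pverts: "dominating_set G (pverts G)"
  unfolding dominating_set_def closed_nbhd_set_def closed_nbhd_def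
  by (auto dest: in_arcsD2)

lemma gamma_set_exists: "\<exists>D. gamma_set G D"
proof -
  have "domination_number G \<in> card ` {S. dominating_set G S}"
    unfolding domination_number_def
    by (rule Min_in) (use finite_dominating_sets dominating_set_pverts in auto)
  then show ?thesis
    unfolding gamma_set_def by force
qed

lemma finite_gamma_sets: "finite {D. gamma_set G D}"
  by (rule finite_subset[OF _ finite_dominating_sets]) (auto simp: gamma_set_def)

lemma graph_power_ge_1:
  assumes "pverts G \<noteq> {}"
  shows "graph_power G \<ge> 1"
proof -
  have "allegiance G D \<ge> 1" if D: "gamma_set G D" for D
  proof -
    have sub: "D \<subseteq> pverts G" and dom: "closed_nbhd_set G D = pverts G"
      using D unfolding gamma_set_def dominating_set_def by auto
    obtain d where d: "d \<in> D"
      using dom assms unfolding closed_nbhd_set_def by auto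
    have "card (D \<inter> closed_nbhd G d) \<ge> 1"
      using d finite_subset[OF sub pair_finite_verts]
      by (metis One_nat_def Suc_leI card_gt_0_iff closed_nbhd_def disjoint_iff finite_Int insertI1)
    also have "\<dots> \<le> allegiance G D"
      unfolding allegiance_def using d sub pair_finite_verts by (intro Max_ge) auto
    finally show ?thesis .
  qed
  then show ?thesis
    unfolding graph_power_def using gamma_set_exists finite_gamma_sets by (subst Min_ge_iff) auto
qed

end

lemma pair_graph_cartesian_product:
  assumes "pair_graph G" "pair_graph H"
  shows "pair_graph (G \<box> H)"
proof -
  interpret G: pair_graph G by fact
  interpret H: pair_graph H by fact
  have vs: "finite (pverts (G \<box> H))"
    by (simp add: cartesian_product_def G.pair_finite_verts H.pair_finite_verts)
  have sub: "parcs (G \<box> H) \<subseteq> pverts (G \<box> H) \<times> pverts (G \<box> H)"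
    by (auto simp: cartesian_product_def dest: G.wellformed' H.wellformed')
  have fin: "finite (parcs (G \<box> H))"
    using finite_subset[OF sub] vs by blast
  have "sym (parcs G)" "sym (parcs H)"
    using G.pair_sym_arcs H.pair_sym_arcs by (simp_all add: symmetric_def)
  then have "symmetric (with_proj (G \<box> H))"
    by (auto simp: symmetric_def cartesian_product_def sym_def)
  moreover have "fst e \<noteq> snd e" if "e \<in> parcs (G \<box> H)" for e
    using that by (auto simp: cartesian_product_def dest: G.pair_no_loops H.pair_no_loops)
  ultimately show ?thesis
    using sub vs fin by unfold_locales auto
qed

end

theory Submission
  imports Defs
begin

text \<open>
  Fix a \<open>\<gamma>\<close>-set \<open>\<Gamma>\<close> of \<open>G\<close> whose allegiance is the power \<open>\<pi>\<close>, and a \<open>\<gamma>\<close>-set \<open>D\<close> of the product.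
  Label every \<open>(g, h) \<in> D\<close> by some \<open>u \<in> \<Gamma> \<inter> N[g]\<close>, by \<open>g\<close> itself if \<open>g \<in> \<Gamma>\<close>. For each \<open>u \<in> \<Gamma>\<close>, the
  vertices of \<open>H\<close> above which the label \<open>u\<close> occurs, together with those whose closed neighbourhood
  does not meet that set, dominate \<open>H\<close>; hence \<open>\<gamma>(G) \<gamma>(H)\<close> is at most the sum over \<open>v\<close> of the number
  of labels \<open>L\<^sub>v\<close> present in layer \<open>v\<close> and the number of labels \<open>S\<^sub>v\<close> missing from layer \<open>v\<close> and from
  all its neighbouring layers.

  Choose the labelling with the fewest equal labels in adjacent layers. Then every point of \<open>D\<close> in
  layer \<open>v\<close> which could have taken a label from \<open>S\<^sub>v\<close> either projects into \<open>\<Gamma>\<close> or carries a label that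
  is absent from the neighbouring layers. If \<open>A\<^sub>v\<close> is the set of points of the latter two kinds and
  \<open>n\<^sub>v\<close> the size of layer \<open>v\<close> of \<open>D\<close>, this gives \<open>|S\<^sub>v| \<le> (\<pi> - 1) |A\<^sub>v|\<close>, whereas minimality of \<open>\<Gamma>\<close> gives
  \<open>|L\<^sub>v| + |S\<^sub>v| \<le> 2 n\<^sub>v - |A\<^sub>v|\<close>. Eliminating \<open>|A\<^sub>v|\<close> yields \<open>\<pi> (|L\<^sub>v| + |S\<^sub>v|) \<le> (2 \<pi> - 1) n\<^sub>v\<close>.
\<close>

text \<open>Minimise the number of ordered \<open>R\<close>-related pairs with equal labels. If
  \<open>x\<close> agrees with a related point while some \<open>u\<close> in \<open>M x\<close> is
  free around it, relabelling \<open>x\<close> by \<open>u\<close> creates no such pair and destroys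
  at least one.\<close>

lemma exists_min_conflict_labelling:
  assumes fin: "finite D" and ne: "\<And>x. x \<in> D \<Longrightarrow> M x \<noteq> {}"
    and sym: "\<And>x y. R x y \<Longrightarrow> R y x" and irrefl: "\<And>x. \<not> R x x"
  obtains l where "\<And>x. x \<in> D \<Longrightarrow> l x \<in> M x"
    and "\<And>x y u. \<lbrakk>x \<in> D; u \<in> M x; \<And>z. \<lbrakk>z \<in> D; R x z\<rbrakk> \<Longrightarrow> l z \<noteq> u; y \<in> D; R x y\<rbrakk> \<Longrightarrow> l y \<noteq> l x"
proof -
  define C where "C l = {(x, y). x \<in> D \<and> y \<in> D \<and> R x y \<and> l x = l y}" for l :: "'a \<Rightarrow> 'b"
  have finC: "finite (C l)" for l
    by (rule finite_subset[of _ "D \<times> D"]) (use fin in \<open>auto simp: C_def\<close>)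
  have "\<forall>x\<in>D. (SOME u. u \<in> M x) \<in> M x"
    using ne by (auto intro: some_in_eq[THEN iffD2])
  then obtain l where l: "\<forall>x\<in>D. l x \<in> M x"
    and min: "\<And>l'. \<forall>x\<in>D. l' x \<in> M x \<Longrightarrow> card (C l) \<le> card (C l')"
    using ex_has_least_nat[of "\<lambda>l. \<forall>x\<in>D. l x \<in> M x" "\<lambda>x. SOME u. u \<in> M x" "\<lambda>l. card (C l)"]
    by blast
  show thesis
  proof
    show "l x \<in> M x" if "x \<in> D" for x
      using l that by blast
    show "l y \<noteq> l x"
      if x: "x \<in> D" and u: "u \<in> M x" and free: "\<And>z. \<lbrakk>z \<in> D; R x z\<rbrakk> \<Longrightarrow> l z \<noteq> u"
        and y: "y \<in> D" "R x y" for x y u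
    proof
      assume eq: "l y = l x"
      define l' where "l' = l(x := u)"
      have "p \<noteq> x \<and> q \<noteq> x \<and> (p, q) \<in> C l" if "(p, q) \<in> C l'" for p q
        using that free[of q] free[of p] sym[of p q] irrefl[of x]
        by (auto simp: C_def l'_def split: if_splits)
      moreover have "(x, y) \<in> C l"
        using x y eq by (simp add: C_def)
      ultimately have "C l' \<subset> C l"
        by fast
      moreover have "card (C l) \<le> card (C l')"
        using l u by (intro min) (auto simp: l'_def)
      ultimately show False
        using psubset_card_mono[OF finC, of "C l'" l] by linarith
    qed
  qed
qed

context pair_graph
begin

lemma closed_nbhd_sym: "v \<in> closed_nbhd G w \<longleftrightarrow> w \<in> closed_nbhd G v"
  using pair_sym_arcs by (auto simp: closed_nbhd_def symmetric_def sym_def)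

lemma dominating_set_iff:
  "dominating_set G S \<longleftrightarrow> S \<subseteq> pverts G \<and> (\<forall>v\<in>pverts G. \<exists>s\<in>S. s \<in> closed_nbhd G v)"
proof -
  have "closed_nbhd_set G S \<subseteq> pverts G" if "S \<subseteq> pverts G"
    using that by (auto simp: closed_nbhd_set_def closed_nbhd_def dest: in_arcsD2)
  then have "dominating_set G S \<longleftrightarrow> S \<subseteq> pverts G \<and> pverts G \<subseteq> closed_nbhd_set G S"
    unfolding dominating_set_def by blast
  moreover have "v \<in> closed_nbhd_set G S \<longleftrightarrow> (\<exists>s\<in>S. s \<in> closed_nbhd G v)" for v
    using closed_nbhd_sym[of v] by (simp add: closed_nbhd_set_def)
  ultimately show ?thesis
    by (simp add: subset_iff Ball_def)
qed

lemma domination_number_le: "dominating_set G S \<Longrightarrow> domination_number G \<le> card S"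
  unfolding domination_number_def using finite_dominating_sets by (intro Min_le) auto

lemma exists_gamma_set_allegiance_eq_power:
  obtains D where "gamma_set G D" "allegiance G D = graph_power G"
proof -
  have "graph_power G \<in> allegiance G ` {D. gamma_set G D}"
    unfolding graph_power_def
    by (rule Min_in) (use gamma_set_exists finite_gamma_sets in auto)
  then show thesis
    using that by force
qed

lemma card_Int_closed_nbhd_le_allegiance:
  "v \<in> pverts G \<Longrightarrow> card (D \<inter> closed_nbhd G v) \<le> allegiance G D"
  unfolding allegiance_def using pair_finite_verts by (intro Max_ge) auto

end

lemma closed_nbhd_cartesian_product:
  assumes "g \<in> pverts G" "h \<in> pverts H"
  shows "x \<in> closed_nbhd (G \<box> H) (g, h) \<longleftrightarrow>
    snd x = h \<and> fst x \<in> closed_nbhd G g \<or> fst x = g \<and> (h, snd x) \<in> parcs H"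
  using assms by (cases x) (auto simp: closed_nbhd_def cartesian_product_def)

theorem theorem2p1:
  fixes G :: "'a pair_pre_digraph" and H :: "'b pair_pre_digraph"
  assumes "pair_graph G" and "Digraph_Component.connected (with_proj G)"
    and "pair_graph H" and "Digraph_Component.connected (with_proj H)"
  shows "real (domination_number (G \<box> H)) \<ge>
    real (graph_power G) / (2 * real (graph_power G) - 1)
      * real (domination_number G) * real (domination_number H)"
proof -
  interpret G: pair_graph G by fact
  interpret H: pair_graph H by fact
  interpret GH: pair_graph "G \<box> H"
    using assms by (intro pair_graph_cartesian_product)
  have "pverts G \<noteq> {}"
    using assms(2) by (auto simp: connected_def strongly_connected_def)
  define p where "p = graph_power G"
  have p: "p \<ge> 1"
    using G.graph_power_ge_1 \<open>pverts G \<noteq> {}\<close> by (simp add: p_def)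
  obtain \<Gamma> where \<Gamma>: "gamma_set G \<Gamma>" "allegiance G \<Gamma> = p"
    using G.exists_gamma_set_allegiance_eq_power by (metis p_def)
  obtain D where D: "gamma_set (G \<box> H) D"
    using GH.gamma_set_exists by blast
  have \<Gamma>_sub: "\<Gamma> \<subseteq> pverts G" and \<Gamma>_dom: "\<And>g. g \<in> pverts G \<Longrightarrow> \<exists>u\<in>\<Gamma>. u \<in> closed_nbhd G g"
    and card_\<Gamma>: "card \<Gamma> = domination_number G"
    using \<Gamma> by (auto simp: gamma_set_def G.dominating_set_iff)
  have fin_\<Gamma>: "finite \<Gamma>"
    using \<Gamma>_sub G.pair_finite_verts finite_subset by blast
  have verts: "pverts (G \<box> H) = pverts G \<times> pverts H"
    by (simp add: cartesian_product_def)
  have D_sub: "D \<subseteq> pverts G \<times> pverts H"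
    and D_dom: "\<And>z. z \<in> pverts (G \<box> H) \<Longrightarrow> \<exists>x\<in>D. x \<in> closed_nbhd (G \<box> H) z"
    and card_D: "card D = domination_number (G \<box> H)"
    using D by (auto simp: gamma_set_def GH.dominating_set_iff verts)
  have D_verts: "fst x \<in> pverts G" "snd x \<in> pverts H" if "x \<in> D" for x
    using that D_sub by auto
  have D_cases: "\<exists>x\<in>D. snd x = h \<and> fst x \<in> closed_nbhd G g \<or> fst x = g \<and> (h, snd x) \<in> parcs H"
    if "g \<in> pverts G" "h \<in> pverts H" for g h
    using D_dom[of "(g, h)"] closed_nbhd_cartesian_product[OF that] that
    by (auto simp: verts)
  have fin_D: "finite D"
    using D_sub G.pair_finite_verts H.pair_finite_verts finite_subset by blast
  \<comment> \<open>The forced label over \<Gamma> is used twice: it makes the points of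
    \<open>A2\<close> redundant below, and it keeps dominators of a missing label out of the
    adjacent layers.\<close>
  define M where "M x = (if fst x \<in> \<Gamma> then {fst x} else \<Gamma> \<inter> closed_nbhd G (fst x))"
    for x :: "'a \<times> 'b"
  have M_ne: "M x \<noteq> {}" if "x \<in> D" for x
    using \<Gamma>_dom[OF D_verts(1)[OF that]] by (auto simp: M_def)
  have arc_sym: "(w, v) \<in> parcs H" if "(v, w) \<in> parcs H" for v w
    using that H.pair_sym_arcs by (auto simp: symmetric_def sym_def)
  have arc_irrefl: "(v, v) \<notin> parcs H" for v
    using H.pair_no_loops[of "(v, v)"] by auto
  obtain l where l: "\<And>x. x \<in> D \<Longrightarrow> l x \<in> M x"
    and l_min: "\<And>x y u. \<lbrakk>x \<in> D; u \<in> M x; \<And>z. \<lbrakk>z \<in> D; (snd x, snd z) \<in> parcs H\<rbrakk> \<Longrightarrow> l z \<noteq> u;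
      y \<in> D; (snd x, snd y) \<in> parcs H\<rbrakk> \<Longrightarrow> l y \<noteq> l x"
    using exists_min_conflict_labelling[of D M "\<lambda>x y. (snd x, snd y) \<in> parcs H"]
      fin_D M_ne arc_sym arc_irrefl by blast
  have l_\<Gamma>: "l x \<in> \<Gamma> \<inter> closed_nbhd G (fst x)" if "x \<in> D" for x
    using l[OF that] by (auto simp: M_def closed_nbhd_def split: if_splits)
  define F where "F v = {x \<in> D. snd x = v}" for v
  define L where "L v = l ` F v" for v
  define W where "W v = {u \<in> \<Gamma>. \<forall>w. (v, w) \<in> parcs H \<longrightarrow> u \<notin> L w}" for v
  define S where "S v = W v - L v" for v
  have fin_F: "finite (F v)" for v
    using fin_D by (simp add: F_def)
  have L_sub: "L v \<subseteq> \<Gamma>" for v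
    using l_\<Gamma> by (auto simp: L_def F_def)
  have W_sub: "W v \<subseteq> \<Gamma>" for v
    by (auto simp: W_def)
  have fins: "finite (L v)" "finite (W v)" "finite (S v)" for v
    using finite_subset[OF L_sub fin_\<Gamma>] finite_subset[OF W_sub fin_\<Gamma>] by (auto simp: S_def)
  have layer: "p * (card (L v) + card (S v)) \<le> (2 * p - 1) * card (F v)"
    if v: "v \<in> pverts H" for v
  proof -
    \<comment> \<open>The set \<open>A\<^sub>v\<close>, split because its disjoint pieces enter
      different counts: \<open>A2\<close> improves the bound on \<open>W v\<close>,
      \<open>A1\<close> the one on \<open>L v\<close>.\<close>
    define A1 where "A1 = {x \<in> F v. l x \<in> W v}"
    define A2 where "A2 = {x \<in> F v. l x \<notin> W v \<and> fst x \<in> \<Gamma>}"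
    have A_sub: "A1 \<subseteq> F v" "A2 \<subseteq> F v" and disj: "A1 \<inter> A2 = {}"
      by (auto simp: A1_def A2_def)
    have finA: "finite A1" "finite A2"
      using A_sub fin_F finite_subset by blast+
    \<comment> \<open>A dominator of \<open>(g, v)\<close> in an adjacent layer lies above
      \<open>g\<close>, and its label, not in \<open>W v\<close>, dominates \<open>g\<close>. One in
      layer \<open>v\<close> serves through its projection; if it is in \<open>A2\<close>, that
      projection is its own label and already lies in \<open>\<Gamma> - W v\<close>.\<close>
    have "dominating_set G ((\<Gamma> - W v) \<union> fst ` (F v - A2))"
      unfolding G.dominating_set_iff
    proof (intro conjI ballI)
      show "(\<Gamma> - W v) \<union> fst ` (F v - A2) \<subseteq> pverts G"
        using \<Gamma>_sub D_verts by (auto simp: F_def)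
      fix g assume g: "g \<in> pverts G"
      from D_cases[OF g v] obtain x where x: "x \<in> D"
        and "snd x = v \<and> fst x \<in> closed_nbhd G g \<or> fst x = g \<and> (v, snd x) \<in> parcs H"
        by blast
      then consider "snd x = v" "fst x \<in> closed_nbhd G g" | "fst x = g" "(v, snd x) \<in> parcs H"
        by blast
      then show "\<exists>s\<in>(\<Gamma> - W v) \<union> fst ` (F v - A2). s \<in> closed_nbhd G g"
      proof cases
        case 1
        have "l x = fst x" if "fst x \<in> \<Gamma>"
          using l[OF x] that by (auto simp: M_def)
        then have "fst x \<in> (\<Gamma> - W v) \<union> fst ` (F v - A2)"
          using 1 x by (cases "x \<in> A2") (auto simp: A2_def F_def)
        then show ?thesis
          using 1 by blast
      next
        case 2
        then have "l x \<notin> W v"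
          using x by (auto simp: W_def L_def F_def)
        then show ?thesis
          using l_\<Gamma>[OF x] 2 by blast
      qed
    qed
    from G.domination_number_le[OF this]
    have "card \<Gamma> \<le> card (\<Gamma> - W v) + card (fst ` (F v - A2))"
      unfolding card_\<Gamma> using card_Un_le order_trans by blast
    also have "card (fst ` (F v - A2)) \<le> card (F v - A2)"
      using fin_F by (intro card_image_le) auto
    finally have "card (W v) + card A2 \<le> card (F v)"
      using card_Diff_subset[OF fins(2) W_sub, of v] card_mono[OF fin_\<Gamma> W_sub, of v]
        card_Diff_subset[OF finA(2) A_sub(2)] card_mono[OF fin_F A_sub(2)] by linarith
    moreover have "card (W v) = card (S v) + card (L v \<inter> W v)"
      using card_Diff_subset_Int[of "W v" "L v"] card_mono[OF fins(2), of "W v \<inter> L v" v] fins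
      by (simp add: S_def Int_commute)
    moreover have "card (L v) + card A1 \<le> card (L v \<inter> W v) + card (F v)"
    proof -
      have "L v \<subseteq> (L v \<inter> W v) \<union> l ` (F v - A1)"
        by (auto simp: L_def A1_def)
      then have "card (L v) \<le> card ((L v \<inter> W v) \<union> l ` (F v - A1))"
        using fins fin_F by (intro card_mono) auto
      also have "\<dots> \<le> card (L v \<inter> W v) + card (l ` (F v - A1))"
        by (rule card_Un_le)
      also have "card (l ` (F v - A1)) \<le> card (F v - A1)"
        using fin_F by (intro card_image_le) auto
      finally show ?thesis
        using card_Diff_subset[OF finA(1) A_sub(1)] card_mono[OF fin_F A_sub(1)] by linarith
    qed
    ultimately have bound1: "card (L v) + card (S v) + card (A1 \<union> A2) \<le> 2 * card (F v)"
      using card_Un_disjoint[OF finA disj] by linarith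
    \<comment> \<open>Look at a dominator of \<open>(u, v)\<close>. In an adjacent layer it would
      lie above \<open>u\<close> and be labelled \<open>u\<close>, which is excluded. So it lies in
      layer \<open>v\<close>; if it does not project into \<Gamma>, it could have taken
      \<open>u\<close>, and \<open>l_min\<close> puts its label in \<open>W v\<close>.\<close>
    have "S v \<subseteq> (\<Union>x\<in>A1 \<union> A2. \<Gamma> \<inter> closed_nbhd G (fst x) - {l x})"
    proof
      fix u assume u: "u \<in> S v"
      then have u_\<Gamma>: "u \<in> \<Gamma>"
        using W_sub by (auto simp: S_def)
      have absent: "l z \<noteq> u" if "z \<in> D" "snd z = v \<or> (v, snd z) \<in> parcs H" for z
        using u that by (auto simp: S_def W_def L_def F_def)
      have "u \<in> pverts G"
        using u_\<Gamma> \<Gamma>_sub by blast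
      from D_cases[OF this v] obtain x where x: "x \<in> D"
        and "snd x = v \<and> fst x \<in> closed_nbhd G u \<or> fst x = u \<and> (v, snd x) \<in> parcs H"
        by blast
      moreover have "l x = u" if "fst x = u"
        using l[OF x] that u_\<Gamma> by (auto simp: M_def)
      ultimately have xv: "snd x = v" and ux: "u \<in> closed_nbhd G (fst x)"
        using absent[OF x] G.closed_nbhd_sym by blast+
      have "l x \<in> W v" if "fst x \<notin> \<Gamma>"
      proof -
        have "u \<in> M x"
          using that ux u_\<Gamma> by (simp add: M_def)
        then have "l y \<noteq> l x" if "y \<in> D" "(v, snd y) \<in> parcs H" for y
          using l_min[OF x, of u y] absent xv that by blast
        then show ?thesis
          using l_\<Gamma>[OF x] by (fastforce simp: W_def L_def F_def)
      qed
      then have "x \<in> A1 \<union> A2"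
        using x xv by (auto simp: A1_def A2_def F_def)
      moreover have "u \<noteq> l x"
        using absent[OF x] xv by blast
      ultimately show "u \<in> (\<Union>x\<in>A1 \<union> A2. \<Gamma> \<inter> closed_nbhd G (fst x) - {l x})"
        using u_\<Gamma> ux by blast
    qed
    then have "card (S v) \<le> card (\<Union>x\<in>A1 \<union> A2. \<Gamma> \<inter> closed_nbhd G (fst x) - {l x})"
      using fin_\<Gamma> finA by (intro card_mono) auto
    also have "\<dots> \<le> (\<Sum>x\<in>A1 \<union> A2. card (\<Gamma> \<inter> closed_nbhd G (fst x) - {l x}))"
      using finA by (intro card_UN_le) auto
    also have "\<dots> \<le> (\<Sum>x\<in>A1 \<union> A2. p - 1)"
    proof (rule sum_mono)
      fix x assume "x \<in> A1 \<union> A2"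
      then have x: "x \<in> D"
        using A_sub by (auto simp: F_def)
      then have "card (\<Gamma> \<inter> closed_nbhd G (fst x)) \<le> p"
        using G.card_Int_closed_nbhd_le_allegiance[OF D_verts(1)] \<Gamma>(2) by metis
      then show "card (\<Gamma> \<inter> closed_nbhd G (fst x) - {l x}) \<le> p - 1"
        using l_\<Gamma>[OF x] by (simp add: card_Diff_singleton)
    qed
    finally have bound2: "card (S v) \<le> (p - 1) * card (A1 \<union> A2)"
      by (simp add: mult.commute)
    have "card (L v) \<le> card (F v)"
      unfolding L_def using fin_F by (intro card_image_le)
    \<comment> \<open>Multiplying \<open>bound1\<close> by \<open>p - 1\<close> makes the term in
      \<open>A1 \<union> A2\<close> cancel against \<open>bound2\<close>; the bound on
      \<open>L v\<close> supplies the rest.\<close>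
    with bound2 mult_le_mono2[OF bound1, of "p - 1"]
    have "(p - 1) * (card (L v) + card (S v)) + (card (L v) + card (S v))
        \<le> (p - 1) * (2 * card (F v)) + card (F v)"
      by (simp add: distrib_left)
    moreover obtain q where "p = Suc q"
      using p by (cases p) auto
    ultimately show ?thesis
      by (simp add: algebra_simps)
  qed
  have "domination_number H \<le> (\<Sum>v\<in>pverts H. of_bool (u \<in> L v) + of_bool (u \<in> S v))"
    if u: "u \<in> \<Gamma>" for u
  proof -
    have "dominating_set H {v \<in> pverts H. u \<in> L v \<union> S v}"
      unfolding H.dominating_set_iff
    proof (intro conjI ballI)
      fix v assume v: "v \<in> pverts H"
      show "\<exists>s\<in>{v \<in> pverts H. u \<in> L v \<union> S v}. s \<in> closed_nbhd H v"
      \<comment> \<open>A label in \<open>W v\<close> is in \<open>L v\<close> or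
        \<open>S v\<close>, so \<open>v\<close> itself serves; otherwise a neighbouring layer
        carries it.\<close>
      proof (cases "u \<in> W v")
        case True
        then show ?thesis
          using v by (intro bexI[of _ v]) (auto simp: S_def closed_nbhd_def)
      next
        case False
        then obtain w where "(v, w) \<in> parcs H" "u \<in> L w"
          using u by (auto simp: W_def)
        then show ?thesis
          by (intro bexI[of _ w]) (auto simp: closed_nbhd_def dest: H.in_arcsD2)
      qed
    qed auto
    then have "domination_number H \<le> card {v \<in> pverts H. u \<in> L v \<union> S v}"
      by (rule H.domination_number_le)
    also have "\<dots> = (\<Sum>v\<in>pverts H. of_bool (u \<in> L v \<union> S v))"
      using H.pair_finite_verts by (simp add: Int_def del: Un_iff)
    also have "\<dots> \<le> (\<Sum>v\<in>pverts H. of_bool (u \<in> L v) + of_bool (u \<in> S v))"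
      by (intro sum_mono) auto
    finally show ?thesis .
  qed
  then have "card \<Gamma> * domination_number H
      \<le> (\<Sum>u\<in>\<Gamma>. \<Sum>v\<in>pverts H. of_bool (u \<in> L v) + of_bool (u \<in> S v))"
    using sum_mono[of \<Gamma> "\<lambda>_. domination_number H"] by simp
  also have "\<dots> = (\<Sum>v\<in>pverts H. card (L v) + card (S v))"
  proof (subst sum.swap, intro sum.cong refl)
    fix v
    have "\<Gamma> \<inter> {u. u \<in> L v} = L v" "\<Gamma> \<inter> {u. u \<in> S v} = S v"
      using L_sub W_sub by (auto simp: S_def)
    then show "(\<Sum>u\<in>\<Gamma>. of_bool (u \<in> L v) + of_bool (u \<in> S v)) = card (L v) + card (S v)"
      using fin_\<Gamma> by (simp add: sum.distrib)
  qed
  finally have "p * (card \<Gamma> * domination_number H) \<le> (\<Sum>v\<in>pverts H. p * (card (L v) + card (S v)))"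
    by (simp flip: sum_distrib_left)
  also have "\<dots> \<le> (\<Sum>v\<in>pverts H. (2 * p - 1) * card (F v))"
    by (intro sum_mono layer)
  also have "\<dots> = (2 * p - 1) * card D"
  proof -
    have "D = (\<Union>v\<in>pverts H. F v)"
      using D_verts by (auto simp: F_def)
    also have "card \<dots> = (\<Sum>v\<in>pverts H. card (F v))"
      using H.pair_finite_verts fin_F by (intro card_UN_disjoint) (auto simp: F_def)
    finally show ?thesis
      by (simp add: sum_distrib_left)
  qed
  finally have "real (p * (domination_number G * domination_number H))
      \<le> real ((2 * p - 1) * domination_number (G \<box> H))"
    unfolding card_\<Gamma> card_D by (intro of_nat_mono)
  \<comment> \<open>As \<open>p\<close> is positive, the truncated \<open>2 * p - 1\<close> agrees
    with the real one, which is a positive denominator.\<close>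
  then have "real p * (real (domination_number G) * real (domination_number H))
      \<le> (2 * real p - 1) * real (domination_number (G \<box> H))"
    using p by (simp add: of_nat_diff)
  then show ?thesis
    using p unfolding p_def by (simp add: field_simps)
qed

end
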